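(* Let $q_1,q_2,q_3\in(0,1)$ with $q_1+q_2+q_3=1$. On $\mathbb{C}^6$ with basis $\{|0\rangle,\dots,|5\rangle\}$ let $\overline{L}_1=\mathbb{I}_6$, and let $\overline{L}_2$, $\overline{L}_3$, $\overline{S}_1$, $\overline{S}_2$, $\overline{S}_3$ be the permutation unitaries that swap $|0\rangle$ with $|1\rangle$, $|2\rangle$, $|3\rangle$, $|4\rangle$, $|5\rangle$ respectively and fix all other basis vectors. Define the noisy unitary channels $\overline{\mathcal{L}}(\rho)=\sum_{k=1}^3 q_k\overline{L}_k\rho\overline{L}_k^\dagger$ and $\overline{\mathcal{S}}(\rho)=\sum_{k=1}^3 q_k\overline{S}_k\rho\overline{S}_k^\dagger$. Then for discriminating $\overline{\mathcal{L}}$ and $\overline{\mathcal{S}}$, a single-system probe is better than a maximally entangled probe: there is a state $\rho$ on $\mathbb{C}^6$ such that for every maximally entangled state $|\Psi\rangle\in\mathbb{C}^6\otimes\mathbb{C}^6$, $$\tfrac12+\tfrac14\|\overline{\mathcal{L}}(\rho)-\overline{\mathcal{S}}(\rho)\|_1>\tfrac12+\tfrac14\|(\overline{\mathcal{L}}\otimes\mathrm{id})(|\Psi\rangle\langle\Psi|)-(\overline{\mathcal{S}}\otimes\mathrm{id})(|\Psi\rangle\langle\Psi|)\|_1.$$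
   Context: For two channels chosen with equal priors $1/2$, the single-shot success probability with a single-system probe $\rho$ is $\frac12+\frac14\|\mathcal{N}_1(\rho)-\mathcal{N}_2(\rho)\|_1$, and with a bipartite probe $\rho_{AB}$ (channel on $A$) it is $\frac12+\frac14\|(\mathcal{N}_1\otimes\mathrm{id})(\rho_{AB})-(\mathcal{N}_2\otimes\mathrm{id})(\rho_{AB})\|_1$; $\|\cdot\|_1$ is the trace norm. A pure state on $\mathbb{C}^6\otimes\mathbb{C}^6$ is maximally entangled if its reduced states are $\mathbb{I}_6/6$. *)

theory Defs
  imports "Jordan_Normal_Form.Schur_Decomposition"
begin

definition mtrace :: "complex mat \<Rightarrow> complex" where
  "mtrace A = (\<Sum>i<dim_row A. A $$ (i,i))"

definition psd :: "complex mat \<Rightarrow> bool" where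
  "psd A \<longleftrightarrow> A \<in> carrier_mat (dim_row A) (dim_row A) \<and> mat_adjoint A = A \<and>
     (\<forall>v \<in> carrier_vec (dim_row A). 0 \<le> Re (\<Sum>i<dim_row A. cnj (v $ i) * (A *\<^sub>v v) $ i))"

definition psd_sqrt :: "complex mat \<Rightarrow> complex mat" where
  "psd_sqrt A = (THE B. B \<in> carrier_mat (dim_row A) (dim_row A) \<and> psd B \<and> B * B = A)"

definition trace_norm :: "complex mat \<Rightarrow> real" where
  "trace_norm A = Re (mtrace (psd_sqrt (mat_adjoint A * A)))"

definition density_mat :: "nat \<Rightarrow> complex mat \<Rightarrow> bool" where
  "density_mat n \<rho> \<longleftrightarrow> \<rho> \<in> carrier_mat n n \<and> psd \<rho> \<and> mtrace \<rho> = 1"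

(* Kronecker product of an n x n and an m x m matrix; index (i,j) of C^n (x) C^m is i*m+j *)
definition kron :: "complex mat \<Rightarrow> complex mat \<Rightarrow> complex mat" where
  "kron A B = mat (dim_row A * dim_row B) (dim_col A * dim_col B)
     (\<lambda>(i,j). A $$ (i div dim_row B, j div dim_col B) * B $$ (i mod dim_row B, j mod dim_col B))"

definition proj :: "complex vec \<Rightarrow> complex mat" where
  "proj \<psi> = mat (dim_vec \<psi>) (dim_vec \<psi>) (\<lambda>(i,j). \<psi> $ i * cnj (\<psi> $ j))"

definition ptrace_B :: "nat \<Rightarrow> nat \<Rightarrow> complex mat \<Rightarrow> complex mat" where
  "ptrace_B n m X = mat n n (\<lambda>(i,k). \<Sum>j<m. X $$ (i*m+j, k*m+j))"
definition ptrace_A :: "nat \<Rightarrow> nat \<Rightarrow> complex mat \<Rightarrow> complex mat" where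
  "ptrace_A n m X = mat m m (\<lambda>(j,l). \<Sum>i<n. X $$ (i*m+j, i*m+l))"

definition max_entangled :: "nat \<Rightarrow> complex vec \<Rightarrow> bool" where
  "max_entangled d \<psi> \<longleftrightarrow> \<psi> \<in> carrier_vec (d*d) \<and> (\<Sum>i<d*d. (cmod (\<psi> $ i))\<^sup>2) = 1 \<and>
     ptrace_B d d (proj \<psi>) = (1 / of_nat d) \<cdot>\<^sub>m 1\<^sub>m d \<and>
     ptrace_A d d (proj \<psi>) = (1 / of_nat d) \<cdot>\<^sub>m 1\<^sub>m d"

definition swp :: "nat \<Rightarrow> nat \<Rightarrow> nat" where
  "swp a i = (if i = 0 then a else if i = a then 0 else i)"

definition swap_mat :: "nat \<Rightarrow> complex mat" where
  "swap_mat a = mat 6 6 (\<lambda>(i,j). if i = swp a j then 1 else 0)"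

definition mix3 :: "real \<Rightarrow> real \<Rightarrow> real \<Rightarrow> complex mat \<Rightarrow> complex mat \<Rightarrow> complex mat \<Rightarrow> complex mat \<Rightarrow> complex mat" where
  "mix3 q1 q2 q3 U1 U2 U3 \<rho> =
     complex_of_real q1 \<cdot>\<^sub>m (U1 * \<rho> * mat_adjoint U1) +
     complex_of_real q2 \<cdot>\<^sub>m (U2 * \<rho> * mat_adjoint U2) +
     complex_of_real q3 \<cdot>\<^sub>m (U3 * \<rho> * mat_adjoint U3)"

definition Lbar :: "real \<Rightarrow> real \<Rightarrow> real \<Rightarrow> complex mat \<Rightarrow> complex mat" where
  "Lbar q1 q2 q3 = mix3 q1 q2 q3 (1\<^sub>m 6) (swap_mat 1) (swap_mat 2)"
definition Sbar :: "real \<Rightarrow> real \<Rightarrow> real \<Rightarrow> complex mat \<Rightarrow> complex mat" where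
  "Sbar q1 q2 q3 = mix3 q1 q2 q3 (swap_mat 3) (swap_mat 4) (swap_mat 5)"

definition Lbar_id :: "real \<Rightarrow> real \<Rightarrow> real \<Rightarrow> complex mat \<Rightarrow> complex mat" where
  "Lbar_id q1 q2 q3 = mix3 q1 q2 q3 (kron (1\<^sub>m 6) (1\<^sub>m 6)) (kron (swap_mat 1) (1\<^sub>m 6)) (kron (swap_mat 2) (1\<^sub>m 6))"
definition Sbar_id :: "real \<Rightarrow> real \<Rightarrow> real \<Rightarrow> complex mat \<Rightarrow> complex mat" where
  "Sbar_id q1 q2 q3 = mix3 q1 q2 q3 (kron (swap_mat 3) (1\<^sub>m 6)) (kron (swap_mat 4) (1\<^sub>m 6)) (kron (swap_mat 5) (1\<^sub>m 6))"

end

theory Submission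
  imports Defs
begin

text \<open>The probe \<open>|0\<rangle>\<langle>0|\<close> is sent to diagonal states with disjoint supports, so its trace norm takes the
  maximal value 2. For a maximally entangled \<open>\<psi>\<close>, the overlap of \<open>(U \<otimes> I)\<psi>\<close> and \<open>(V \<otimes> I)\<psi>\<close> is
  \<open>tr(U\<^sup>* V)/6\<close>; for the identity and a transposition this is \<open>4/6\<close>, so the two output states are not
  orthogonal and the trace norm is below 2. Evaluating the trace norm rests on the spectral theorem,
  which gives both existence and uniqueness of the positive square root.\<close>

text \<open>In both settings the difference of the outputs is a signed sum of six rank-one
  projections with weights \<open>q1, q2, q3, -q1, -q2, -q3\<close>, whose absolute values add up to
  2. This value is reached when the six vectors are orthonormal and missed as soon as two vectors of
  opposite sign overlap; a plain triangle inequality would not give strictness, so the eigenvalues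
  are compared one by one. The label 0 is the only one moved by every nontrivial swap, hence
  \<open>|0>\<close> separates all six unitaries, while a maximally entangled state averages over
  all labels, several of which any two of the unitaries treat alike. The matrix part is long because
  the trace norm goes through a definite description: it has no usable value until a positive square
  root is exhibited and shown to be the only one.\<close>

section \<open>Entries of products and adjoints\<close>

lemma index_mult_mat_sum:
  assumes "A \<in> carrier_mat m n" "B \<in> carrier_mat n k" "i < m" "j < k"
  shows "(A * B) $$ (i, j) = (\<Sum>l<n. A $$ (i, l) * B $$ (l, j))"
  using assms by (simp add: scalar_prod_def lessThan_atLeast0)

lemma index_mult_mat_vec_sum:
  assumes "A \<in> carrier_mat m n" "v \<in> carrier_vec n" "i < m"
  shows "(A *\<^sub>v v) $ i = (\<Sum>j<n. A $$ (i, j) * v $ j)"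
  using assms by (simp add: scalar_prod_def lessThan_atLeast0)

lemma dim_mat_adjoint [simp]:
  "dim_row (mat_adjoint A) = dim_col A" "dim_col (mat_adjoint A) = dim_row A"
  unfolding mat_adjoint_def by auto

lemma mat_adjoint_carrier [simp]:
  "A \<in> carrier_mat m n \<Longrightarrow> mat_adjoint A \<in> carrier_mat n m"
  by (rule carrier_matI) simp_all

lemma index_mat_adjoint [simp]:
  fixes A :: "complex mat"
  assumes "i < dim_col A" "j < dim_row A"
  shows "mat_adjoint A $$ (i, j) = cnj (A $$ (j, i))"
  using assms unfolding mat_adjoint_def by (simp add: mat_of_rows_index)

lemma mat_adjoint_adjoint [simp]: "mat_adjoint (mat_adjoint A) = (A :: complex mat)"
  by (rule eq_matI) simp_all

lemma mat_adjoint_mult: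
  fixes A B :: "complex mat"
  assumes "A \<in> carrier_mat m n" "B \<in> carrier_mat n k"
  shows "mat_adjoint (A * B) = mat_adjoint B * mat_adjoint A"
proof (rule eq_matI)
  fix i j assume "i < dim_row (mat_adjoint B * mat_adjoint A)" "j < dim_col (mat_adjoint B * mat_adjoint A)"
  then have ij: "i < k" "j < m" using assms by auto
  have "mat_adjoint (A * B) $$ (i, j) = (\<Sum>l = 0..<n. cnj (A $$ (j, l) * B $$ (l, i)))"
    using assms ij by (simp add: scalar_prod_def)
  also have "\<dots> = (\<Sum>l = 0..<n. cnj (B $$ (l, i)) * cnj (A $$ (j, l)))"
    by (simp add: mult.commute)
  also have "\<dots> = (mat_adjoint B * mat_adjoint A) $$ (i, j)"
    using assms ij by (simp add: scalar_prod_def)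
  finally show "mat_adjoint (A * B) $$ (i, j) = (mat_adjoint B * mat_adjoint A) $$ (i, j)" .
qed (use assms in auto)

section \<open>Unitary matrices\<close>

definition unitary_mat :: "nat \<Rightarrow> complex mat \<Rightarrow> bool" where
  "unitary_mat n R \<longleftrightarrow> R \<in> carrier_mat n n \<and> mat_adjoint R * R = 1\<^sub>m n"

text \<open>A left inverse of a square matrix is also a right inverse; orthonormal columns therefore
  give orthonormal rows.\<close>

lemma unitary_matD:
  assumes "unitary_mat n R"
  shows "R \<in> carrier_mat n n" "mat_adjoint R \<in> carrier_mat n n"
    "mat_adjoint R * R = 1\<^sub>m n" "R * mat_adjoint R = 1\<^sub>m n"
  using assms mat_mult_left_right_inverse[of "mat_adjoint R" n R]
  unfolding unitary_mat_def by auto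

lemma unitary_mat_mult:
  assumes "unitary_mat n R" "unitary_mat n S"
  shows "unitary_mat n (R * S)"
proof -
  note R = unitary_matD[OF assms(1)] and S = unitary_matD[OF assms(2)]
  have "mat_adjoint (R * S) * (R * S) = mat_adjoint S * (mat_adjoint R * R) * S"
    using R(1,2) S(1,2) by (simp add: mat_adjoint_mult[OF R(1) S(1)] assoc_mult_mat[of _ n n _ n _ n]
        mult_carrier_mat[of _ n n _ n])
  then show ?thesis using R S unfolding unitary_mat_def by auto
qed

text \<open>Merges two successive changes of basis. In the spectral theorem \<open>W\<close> exposes
  an eigenvector and \<open>P\<close> diagonalizes the remaining block.\<close>

lemma conj_conj:
  fixes W P M :: "complex mat"
  assumes W: "W \<in> carrier_mat n n" and P: "P \<in> carrier_mat n n" and M: "M \<in> carrier_mat n n"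
  shows "W * (P * M * mat_adjoint P) * mat_adjoint W = W * P * M * mat_adjoint (W * P)"
proof -
  have a: "mat_adjoint P \<in> carrier_mat n n" "mat_adjoint W \<in> carrier_mat n n" "P * M \<in> carrier_mat n n"
    "W * P * M \<in> carrier_mat n n"
    using W P M by auto
  have "W * (P * M * mat_adjoint P) = W * P * M * mat_adjoint P"
    using assoc_mult_mat[OF W a(3,1)] assoc_mult_mat[OF W P M] by simp
  then show ?thesis
    using assoc_mult_mat[OF a(4,1,2)] mat_adjoint_mult[OF W P] by simp
qed

lemma unitary_conj_cancel:
  assumes W: "unitary_mat n W" and A: "A \<in> carrier_mat n n"
  shows "W * (mat_adjoint W * (A * W)) * mat_adjoint W = A"
proof -
  note W = unitary_matD[OF W]
  have AW: "A * W \<in> carrier_mat n n" using A W(1) by auto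
  have "W * (mat_adjoint W * (A * W)) = A * W"
    using assoc_mult_mat[OF W(1,2) AW] W(4) left_mult_one_mat[OF AW] by simp
  then show ?thesis using assoc_mult_mat[OF A W(1,2)] W(4) A by simp
qed

lemma unitary_columns:
  assumes "unitary_mat n R" "k < n" "l < n"
  shows "(\<Sum>i<n. cnj (R $$ (i, k)) * R $$ (i, l)) = (if k = l then 1 else 0)"
proof -
  note R = unitary_matD[OF assms(1)]
  have "(mat_adjoint R * R) $$ (k, l) = (\<Sum>i<n. cnj (R $$ (i, k)) * R $$ (i, l))"
    using R(1) assms(2,3) by (auto simp: scalar_prod_def lessThan_atLeast0)
  then show ?thesis using R(3) assms(2,3) by simp
qed

lemma unitary_rows:
  assumes "unitary_mat n R" "k < n" "l < n"
  shows "(\<Sum>i<n. R $$ (k, i) * cnj (R $$ (l, i))) = (if k = l then 1 else 0)"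
proof -
  note R = unitary_matD[OF assms(1)]
  have "(R * mat_adjoint R) $$ (k, l) = (\<Sum>i<n. R $$ (k, i) * cnj (R $$ (l, i)))"
    using R(1) assms(2,3) by (auto simp: scalar_prod_def lessThan_atLeast0)
  then show ?thesis using R(4) assms(2,3) by simp
qed

section \<open>The spectral theorem for Hermitian matrices\<close>

text \<open>Complete \<open>v\<close> to a basis, apply Gram-Schmidt, which keeps the first vector,
  and normalize. The scalar \<open>c\<close> is the inverse of the norm of \<open>v\<close>.\<close>

lemma unitary_with_first_column:
  fixes v :: "complex vec"
  assumes v: "v \<in> carrier_vec n" and v0: "v \<noteq> 0\<^sub>v n"
  obtains W c where "unitary_mat n W" "col W 0 = c \<cdot>\<^sub>v v"
proof -
  have n: "n > 0" using v v0 by (cases n) auto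
  interpret cof_vec_space n "TYPE(complex)" .
  define b where "b = basis_completion v"
  define ws where "ws = gram_schmidt n b"
  note B = basis_completion[OF v v0, folded b_def]
  then obtain vs where bv: "b = v # vs" using n by (cases b) auto
  note ws = gram_schmidt_result(2-4)[OF B(2,4,5) refl, folded ws_def]
  have hd: "hd ws = v" using gram_schmidt_hd[OF v, of vs, folded bv] unfolding ws_def .
  have len: "length ws = n" using ws(3) B(6) by simp
  have cv: "ws ! i \<in> carrier_vec n" if "i < n" for i using ws(2) len that by auto
  define s where "s i = (\<Sum>k<n. (cmod (ws ! i $ k))\<^sup>2)" for i
  have ip: "ws ! j \<bullet>c ws ! i = (\<Sum>k<n. cnj (ws ! i $ k) * ws ! j $ k)" if "i < n" "j < n" for i j
    using cv[OF that(1)] cv[OF that(2)]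
    by (auto simp: scalar_prod_def conjugate_complex_def lessThan_atLeast0 mult.commute)
  have self: "(\<Sum>k<n. cnj (ws ! i $ k) * ws ! i $ k) = complex_of_real (s i)" for i
    unfolding s_def of_real_sum by (intro sum.cong refl) (metis complex_norm_square mult.commute)
  have orth: "(\<Sum>k<n. cnj (ws ! i $ k) * ws ! j $ k) = 0 \<longleftrightarrow> i \<noteq> j" if "i < n" "j < n" for i j
    using corthogonalD[OF ws(1), of j i] ip[OF that] that len by auto
  \<comment> \<open>\<open>corthogonal\<close> is an equivalence: a product vanishes exactly for
    distinct indices, so self products are nonzero and may be divided by.\<close>
  have s_pos: "s i > 0" if "i < n" for i
    using orth[OF that that] self[of i] sum_nonneg[of "{..<n}" "\<lambda>k. (cmod (ws ! i $ k))\<^sup>2"]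
    unfolding s_def[symmetric] by force
  define W where "W = mat n n (\<lambda>(i, j). ws ! j $ i / complex_of_real (sqrt (s j)))"
  have W: "W \<in> carrier_mat n n" unfolding W_def by simp
  have "mat_adjoint W * W = 1\<^sub>m n"
  proof (rule eq_matI)
    fix i j assume "i < dim_row (1\<^sub>m n :: complex mat)" "j < dim_col (1\<^sub>m n :: complex mat)"
    then have i: "i < n" and j: "j < n" by auto
    have "(mat_adjoint W * W) $$ (i, j) = (\<Sum>k<n. cnj (W $$ (k, i)) * W $$ (k, j))"
      using i j W by (auto simp: scalar_prod_def lessThan_atLeast0)
    also have "\<dots> = (\<Sum>k<n. cnj (ws ! i $ k) * ws ! j $ k) / (of_real (sqrt (s i)) * of_real (sqrt (s j)))"
      unfolding sum_divide_distrib using i j by (intro sum.cong) (auto simp: W_def)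
    also have "\<dots> = 1\<^sub>m n $$ (i, j)"
    proof (cases "i = j")
      case True
      have "complex_of_real (sqrt (s j)) * of_real (sqrt (s j)) = of_real (s j)"
        using s_pos[OF j] by (simp flip: of_real_mult)
      then show ?thesis using True i j s_pos[OF j] self[of j] by auto
    next
      case False
      then show ?thesis using orth[OF i j] i j by simp
    qed
    finally show "(mat_adjoint W * W) $$ (i, j) = 1\<^sub>m n $$ (i, j)" .
  qed (use W in auto)
  then have "unitary_mat n W" using W unfolding unitary_mat_def by simp
  moreover have "col W 0 = (1 / complex_of_real (sqrt (s 0))) \<cdot>\<^sub>v v"
  proof -
    have "ws ! 0 = v" using hd len n by (metis hd_conv_nth length_greater_0_conv)
    then show ?thesis using n v by (auto simp: W_def)
  qed
  ultimately show ?thesis by (rule that)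
qed

text \<open>Over the complex numbers the characteristic polynomial splits into \<open>n\<close>
  linear factors, and \<open>n > 0\<close> supplies one of them.\<close>

lemma complex_eigenvector_exists:
  fixes A :: "complex mat"
  assumes A: "A \<in> carrier_mat n n" and n: "n > 0"
  obtains v e where "v \<in> carrier_vec n" "v \<noteq> 0\<^sub>v n" "A *\<^sub>v v = e \<cdot>\<^sub>v v"
proof -
  obtain es where es: "char_poly A = (\<Prod>e\<leftarrow>es. [:- e, 1:])" "length es = n"
    using char_poly_factorized[OF A] by blast
  then obtain e fs where "es = e # fs" using n by (cases es) auto
  then have "eigenvalue A e" using es(1) eigenvalue_root_char_poly[OF A] by simp
  then show ?thesis using that A unfolding eigenvalue_def eigenvector_def by auto
qed

lemma mat_adjoint_block_diag:
  fixes A D :: "complex mat"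
  assumes "A \<in> carrier_mat m m" "D \<in> carrier_mat n n"
  shows "mat_adjoint (four_block_mat A (0\<^sub>m m n) (0\<^sub>m n m) D) =
    four_block_mat (mat_adjoint A) (0\<^sub>m m n) (0\<^sub>m n m) (mat_adjoint D)"
  using assms by (intro eq_matI) auto

lemma mult_block_diag:
  fixes A B C D :: "complex mat"
  assumes "A \<in> carrier_mat m m" "B \<in> carrier_mat n n" "C \<in> carrier_mat m m" "D \<in> carrier_mat n n"
  shows "four_block_mat A (0\<^sub>m m n) (0\<^sub>m n m) B * four_block_mat C (0\<^sub>m m n) (0\<^sub>m n m) D =
    four_block_mat (A * C) (0\<^sub>m m n) (0\<^sub>m n m) (B * D)"
  using assms by (subst mult_four_block_mat) auto

text \<open>Deflation by induction on the dimension: in a basis that starts with an eigenvector, a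
  Hermitian matrix splits into a 1 by 1 corner and a smaller Hermitian block.\<close>

theorem hermitian_spectral:
  fixes A :: "complex mat"
  assumes "A \<in> carrier_mat n n" "mat_adjoint A = A"
  obtains R d where "unitary_mat n R"
    "A = R * mat_diag n (\<lambda>i. complex_of_real (d i)) * mat_adjoint R"
proof -
  have "\<exists>R d. unitary_mat n R \<and> A = R * mat_diag n (\<lambda>i. complex_of_real (d i)) * mat_adjoint R"
    using assms
  proof (induction n arbitrary: A)
    case 0
    then show ?case
      by (intro exI[of _ "1\<^sub>m 0"] exI[of _ "\<lambda>_. 0"]) (auto simp: unitary_mat_def)
  next
    case (Suc n A)
    note A = Suc.prems
    obtain v e where v: "v \<in> carrier_vec (Suc n)" "v \<noteq> 0\<^sub>v (Suc n)" and ev: "A *\<^sub>v v = e \<cdot>\<^sub>v v"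
      using complex_eigenvector_exists[OF A(1)] by auto
    obtain W c where uW: "unitary_mat (Suc n) W" and W0: "col W 0 = c \<cdot>\<^sub>v v"
      using unitary_with_first_column[OF v] .
    note W = unitary_matD[OF uW]
    define C where "C = mat_adjoint W * (A * W)"
    have C: "C \<in> carrier_mat (Suc n) (Suc n)" using A W unfolding C_def by auto
    have Cadj: "mat_adjoint C = C"
      unfolding C_def using A W
      by (simp add: mat_adjoint_mult[of _ "Suc n" "Suc n" _ "Suc n"] assoc_mult_mat[of _ "Suc n" "Suc n" _ "Suc n" _ "Suc n"])
    \<comment> \<open>Since \<open>col W 0\<close> is an eigenvector, the first column of
      \<open>C\<close> is \<open>e\<close> times the first column of
      \<open>mat_adjoint W * W\<close>, the identity.\<close>
    have C0: "C $$ (i, 0) = (if i = 0 then e else 0)" if i: "i < Suc n" for i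
    proof -
      have evW: "A *\<^sub>v col W 0 = e \<cdot>\<^sub>v col W 0"
        unfolding W0 using A v ev by (simp add: mult_mat_vec smult_smult_assoc mult.commute)
      have AW: "(A * W) $$ (l, 0) = e * W $$ (l, 0)" if l: "l < Suc n" for l
      proof -
        have "(A * W) $$ (l, 0) = (A *\<^sub>v col W 0) $ l" using A(1) W(1) l by simp
        also have "\<dots> = e * W $$ (l, 0)" unfolding evW using W(1) l by simp
        finally show ?thesis .
      qed
      have AWc: "A * W \<in> carrier_mat (Suc n) (Suc n)" by (rule mult_carrier_mat[OF A(1) W(1)])
      have "C $$ (i, 0) = (\<Sum>l<Suc n. mat_adjoint W $$ (i, l) * (A * W) $$ (l, 0))"
        unfolding C_def by (rule index_mult_mat_sum[OF W(2) AWc i]) simp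
      also have "\<dots> = (\<Sum>l<Suc n. e * (mat_adjoint W $$ (i, l) * W $$ (l, 0)))"
        by (intro sum.cong refl) (simp only: AW lessThan_iff mult.left_commute)
      also have "\<dots> = e * (mat_adjoint W * W) $$ (i, 0)"
        unfolding sum_distrib_left[symmetric] using index_mult_mat_sum[OF W(2,1) i, of 0] by simp
      finally show ?thesis using W(3) i by simp
    qed
    have Csym: "C $$ (i, j) = cnj (C $$ (j, i))" if "i < Suc n" "j < Suc n" for i j
      using index_mat_adjoint[of i C j] that C Cadj by simp
    \<comment> \<open>The corner entry of a Hermitian matrix is real; this is what allows a
      real-valued \<open>d\<close>.\<close>
    have "cnj e = e" using Csym[of 0 0] C0[of 0] by simp
    then have e: "complex_of_real (Re e) = e" by (simp add: complex_eq_iff)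
    define D where "D = mat n n (\<lambda>(i, j). C $$ (Suc i, Suc j))"
    have D: "D \<in> carrier_mat n n" unfolding D_def by simp
    have "mat_adjoint D = D"
      by (rule eq_matI) (auto simp: D_def intro: Csym[symmetric])
    from Suc.IH[OF D this] obtain R d where uR: "unitary_mat n R"
      and DR: "D = R * mat_diag n (\<lambda>i. complex_of_real (d i)) * mat_adjoint R" by blast
    note R = unitary_matD[OF uR]
    define E where "E = mat (Suc 0) (Suc 0) (\<lambda>_. e)"
    have E: "E \<in> carrier_mat (Suc 0) (Suc 0)" unfolding E_def by simp
    \<comment> \<open>The first row vanishes off the corner as the conjugate of the first
      column.\<close>
    have Cblock: "C = four_block_mat E (0\<^sub>m (Suc 0) n) (0\<^sub>m n (Suc 0)) D"
    proof (rule eq_matI)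
      fix i j assume "i < dim_row (four_block_mat E (0\<^sub>m (Suc 0) n) (0\<^sub>m n (Suc 0)) D)"
        "j < dim_col (four_block_mat E (0\<^sub>m (Suc 0) n) (0\<^sub>m n (Suc 0)) D)"
      then have ij: "i < Suc n" "j < Suc n" using E D by auto
      show "C $$ (i, j) = four_block_mat E (0\<^sub>m (Suc 0) n) (0\<^sub>m n (Suc 0)) D $$ (i, j)"
        using ij C0[OF ij(1)] C0[OF ij(2)] Csym[OF ij]
        by (cases i; cases j) (auto simp: E_def D_def)
    qed (use C E D in auto)
    \<comment> \<open>The new eigenvalue takes index 0 and the inherited ones shift by one, in
      accordance with the block order.\<close>
    define d' where "d' = case_nat (Re e) d"
    define P where "P = four_block_mat (1\<^sub>m (Suc 0)) (0\<^sub>m (Suc 0) n) (0\<^sub>m n (Suc 0)) R"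
    have P: "P \<in> carrier_mat (Suc n) (Suc n)"
      unfolding P_def using four_block_carrier_mat[of "1\<^sub>m (Suc 0)" 1 1 R n n] R by simp
    have adj1: "mat_adjoint (1\<^sub>m (Suc 0)) = (1\<^sub>m (Suc 0) :: complex mat)"
      by (rule eq_matI) auto
    have Padj: "mat_adjoint P =
        four_block_mat (1\<^sub>m (Suc 0)) (0\<^sub>m (Suc 0) n) (0\<^sub>m n (Suc 0)) (mat_adjoint R)"
      unfolding P_def using R by (subst mat_adjoint_block_diag) (auto simp: adj1)
    have uP: "unitary_mat (Suc n) P"
      unfolding unitary_mat_def Padj using P R
      by (simp add: P_def mult_block_diag[of _ "Suc 0" _ n])
    have dd: "mat_diag (Suc n) (\<lambda>i. complex_of_real (d' i)) =
        four_block_mat E (0\<^sub>m (Suc 0) n) (0\<^sub>m n (Suc 0)) (mat_diag n (\<lambda>i. complex_of_real (d i)))"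
      by (rule eq_matI) (auto simp: mat_diag_def d'_def E_def e split: nat.splits)
    have CP: "C = P * mat_diag (Suc n) (\<lambda>i. complex_of_real (d' i)) * mat_adjoint P"
      unfolding Padj dd unfolding Cblock P_def using R E
      by (simp add: mult_block_diag[of _ "Suc 0" _ n] DR)
    have "A = W * C * mat_adjoint W"
      using unitary_conj_cancel[OF uW A(1)] unfolding C_def by simp
    also have "\<dots> = (W * P) * mat_diag (Suc n) (\<lambda>i. complex_of_real (d' i)) * mat_adjoint (W * P)"
      unfolding CP using conj_conj[OF W(1) P mat_diag_dim] .
    finally show ?case using unitary_mat_mult[OF uW uP] by blast
  qed
  then show ?thesis using that by blast
qed


section \<open>Calculus with a fixed eigenbasis\<close>

text \<open>With \<open>R\<close> fixed and \<open>d\<close> varying, this is functional calculus: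
  squares and absolute values of matrices become operations on real eigenvalues.\<close>

abbreviation spectral_mat :: "nat \<Rightarrow> complex mat \<Rightarrow> (nat \<Rightarrow> real) \<Rightarrow> complex mat" where
  "spectral_mat n R d \<equiv> R * mat_diag n (\<lambda>i. complex_of_real (d i)) * mat_adjoint R"

lemma index_spectral_mat:
  assumes R: "R \<in> carrier_mat n n" and ij: "i < n" "j < n"
  shows "spectral_mat n R d $$ (i, j) = (\<Sum>k<n. d k * R $$ (i, k) * cnj (R $$ (j, k)))"
proof -
  have "spectral_mat n R d $$ (i, j) =
      (\<Sum>k<n. mat n n (\<lambda>(i, j). R $$ (i, j) * complex_of_real (d j)) $$ (i, k) * mat_adjoint R $$ (k, j))"
    unfolding mat_diag_mult_right[OF R] using R ij by (simp add: scalar_prod_def lessThan_atLeast0)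
  also have "\<dots> = (\<Sum>k<n. d k * R $$ (i, k) * cnj (R $$ (j, k)))"
    using R ij by (intro sum.cong) (simp_all add: mult_ac)
  finally show ?thesis .
qed

lemma spectral_mat_carrier [simp]: "R \<in> carrier_mat n n \<Longrightarrow> spectral_mat n R d \<in> carrier_mat n n"
  by (intro mult_carrier_mat[of _ n n _ n] mat_diag_dim mat_adjoint_carrier)

lemma mat_adjoint_spectral:
  assumes R: "R \<in> carrier_mat n n"
  shows "mat_adjoint (spectral_mat n R d) = spectral_mat n R d"
proof (rule eq_matI)
  fix i j assume "i < dim_row (spectral_mat n R d)" "j < dim_col (spectral_mat n R d)"
  then have ij: "i < n" "j < n" using R by simp_all
  then have "mat_adjoint (spectral_mat n R d) $$ (i, j) = cnj (spectral_mat n R d $$ (j, i))"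
    using R by (intro index_mat_adjoint) simp_all
  also have "\<dots> = spectral_mat n R d $$ (i, j)"
    unfolding index_spectral_mat[OF R ij] index_spectral_mat[OF R ij(2,1)] cnj_sum
    by (intro sum.cong) (simp_all add: mult_ac)
  finally show "mat_adjoint (spectral_mat n R d) $$ (i, j) = spectral_mat n R d $$ (i, j)" .
qed (use R in simp_all)

lemma spectral_mat_mult:
  assumes "unitary_mat n R"
  shows "spectral_mat n R d * spectral_mat n R e = spectral_mat n R (\<lambda>i. d i * e i)"
proof -
  note R = unitary_matD[OF assms]
  let ?D = "mat_diag n (\<lambda>i. complex_of_real (d i))" and ?E = "mat_diag n (\<lambda>i. complex_of_real (e i))"
  have c: "?D \<in> carrier_mat n n" "?E \<in> carrier_mat n n" "R * ?D \<in> carrier_mat n n"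
    "?E * mat_adjoint R \<in> carrier_mat n n"
    using R(1,2) by (auto intro: mult_carrier_mat[of _ n n _ n])
  have "spectral_mat n R d * spectral_mat n R e = R * ?D * (mat_adjoint R * (R * (?E * mat_adjoint R)))"
    using assoc_mult_mat[OF R(1) c(2) R(2)] assoc_mult_mat[OF c(3) R(2)]
    by (metis R(1,2) c(2) mult_carrier_mat)
  also have "mat_adjoint R * (R * (?E * mat_adjoint R)) = ?E * mat_adjoint R"
    using assoc_mult_mat[OF R(2,1) c(4)] R(3) left_mult_one_mat[OF c(4)] by simp
  also have "R * ?D * (?E * mat_adjoint R) = R * (?D * ?E) * mat_adjoint R"
    using assoc_mult_mat[OF c(3,2) R(2)] assoc_mult_mat[OF R(1) c(1,2)] by simp
  also have "?D * ?E = mat_diag n (\<lambda>i. complex_of_real (d i * e i))" by simp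
  finally show ?thesis .
qed

lemma mtrace_spectral:
  assumes "unitary_mat n R"
  shows "mtrace (spectral_mat n R d) = complex_of_real (\<Sum>k<n. d k)"
proof -
  note R = unitary_matD[OF assms]
  have "mtrace (spectral_mat n R d) = (\<Sum>i<n. \<Sum>k<n. d k * R $$ (i, k) * cnj (R $$ (i, k)))"
    unfolding mtrace_def using R(1) by (simp add: index_spectral_mat del: index_mult_mat(1))
  also have "\<dots> = (\<Sum>k<n. \<Sum>i<n. d k * R $$ (i, k) * cnj (R $$ (i, k)))"
    by (rule sum.swap)
  also have "\<dots> = (\<Sum>k<n. d k * (\<Sum>i<n. cnj (R $$ (i, k)) * R $$ (i, k)))"
    by (simp add: sum_distrib_left mult_ac)
  also have "\<dots> = (\<Sum>k<n. complex_of_real (d k))"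
    by (intro sum.cong) (simp_all add: unitary_columns[OF assms])
  finally show ?thesis by simp
qed

text \<open>The family \<open>a\<close> is arbitrary, not orthonormal, so that one computation
  serves the columns of an eigenbasis, the output vectors of the channels and a single pure
  state.\<close>

lemma quadratic_form_weighted_proj:
  fixes X :: "complex mat" and c :: "'k \<Rightarrow> real" and a :: "'k \<Rightarrow> nat \<Rightarrow> complex"
  assumes X: "X \<in> carrier_mat n n" and v: "v \<in> carrier_vec n"
    and entries: "\<And>i j. i < n \<Longrightarrow> j < n \<Longrightarrow> X $$ (i, j) = (\<Sum>k\<in>K. c k * a k i * cnj (a k j))"
  shows "(\<Sum>i<n. cnj (v $ i) * (X *\<^sub>v v) $ i) =
    complex_of_real (\<Sum>k\<in>K. c k * (cmod (\<Sum>j<n. cnj (a k j) * v $ j))\<^sup>2)"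
proof -
  define w where "w k = (\<Sum>j<n. cnj (a k j) * v $ j)" for k
  have "(\<Sum>i<n. cnj (v $ i) * (X *\<^sub>v v) $ i) = (\<Sum>i<n. \<Sum>k\<in>K. cnj (v $ i) * (c k * a k i * w k))"
  proof (intro sum.cong refl)
    fix i assume "i \<in> {..<n}"
    then have i: "i < n" by simp
    have "(X *\<^sub>v v) $ i = (\<Sum>j<n. X $$ (i, j) * v $ j)"
      by (rule index_mult_mat_vec_sum[OF X v i])
    also have "\<dots> = (\<Sum>j<n. (\<Sum>k\<in>K. c k * a k i * cnj (a k j)) * v $ j)"
      using i by (simp add: entries)
    also have "\<dots> = (\<Sum>k\<in>K. \<Sum>j<n. c k * a k i * cnj (a k j) * v $ j)"
      unfolding sum_distrib_right by (rule sum.swap)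
    also have "\<dots> = (\<Sum>k\<in>K. c k * a k i * w k)"
      unfolding w_def sum_distrib_left mult.assoc ..
    finally show "cnj (v $ i) * (X *\<^sub>v v) $ i = (\<Sum>k\<in>K. cnj (v $ i) * (c k * a k i * w k))"
      by (simp add: sum_distrib_left)
  qed
  also have "\<dots> = (\<Sum>k\<in>K. \<Sum>i<n. cnj (v $ i) * (c k * a k i * w k))"
    by (rule sum.swap)
  also have "\<dots> = (\<Sum>k\<in>K. complex_of_real (c k * (cmod (w k))\<^sup>2))"
  proof (intro sum.cong refl)
    fix k
    have "cnj (w k) = (\<Sum>i<n. a k i * cnj (v $ i))" unfolding w_def cnj_sum by simp
    then have "(\<Sum>i<n. cnj (v $ i) * (c k * a k i * w k)) = c k * (w k * cnj (w k))"
      by (simp add: sum_distrib_left mult_ac)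
    also have "\<dots> = complex_of_real (c k * (cmod (w k))\<^sup>2)"
      unfolding complex_norm_square[symmetric] by simp
    finally show "(\<Sum>i<n. cnj (v $ i) * (c k * a k i * w k)) = complex_of_real (c k * (cmod (w k))\<^sup>2)" .
  qed
  finally show ?thesis unfolding w_def by simp
qed

lemma quadratic_form_spectral:
  assumes R: "R \<in> carrier_mat n n" and v: "v \<in> carrier_vec n"
  shows "(\<Sum>i<n. cnj (v $ i) * (spectral_mat n R d *\<^sub>v v) $ i) =
    complex_of_real (\<Sum>k<n. d k * (cmod (\<Sum>j<n. cnj (R $$ (j, k)) * v $ j))\<^sup>2)"
  by (rule quadratic_form_weighted_proj[OF spectral_mat_carrier[OF R] v, where a = "\<lambda>k i. R $$ (i, k)"])
    (rule index_spectral_mat[OF R])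

text \<open>Orthonormality of the columns leaves one term. Eigenvalues thus become values of the
  quadratic form, which gives access to their signs and to their expansion in other vectors.\<close>

lemma quadratic_form_column:
  assumes uR: "unitary_mat n R" and k: "k < n"
  shows "(\<Sum>i<n. cnj (col R k $ i) * (spectral_mat n R d *\<^sub>v col R k) $ i) = complex_of_real (d k)"
proof -
  note R = unitary_matD[OF uR]
  have c: "col R k \<in> carrier_vec n" using R(1) by auto
  have "(\<Sum>l<n. d l * (cmod (\<Sum>j<n. cnj (R $$ (j, l)) * col R k $ j))\<^sup>2) = (\<Sum>l<n. if l = k then d l else 0)"
  proof (rule sum.cong)
    fix l assume "l \<in> {..<n}"
    then have "(\<Sum>j<n. cnj (R $$ (j, l)) * col R k $ j) = (if l = k then 1 else 0)"
      using unitary_columns[OF uR, of l k] k R(1) by simp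
    then show "d l * (cmod (\<Sum>j<n. cnj (R $$ (j, l)) * col R k $ j))\<^sup>2 = (if l = k then d l else 0)"
      by simp
  qed simp
  also have "\<dots> = d k" using k by simp
  finally show ?thesis unfolding quadratic_form_spectral[OF R(1) c] by simp
qed

lemma psd_spectral:
  assumes R: "R \<in> carrier_mat n n" and d: "\<And>k. k < n \<Longrightarrow> 0 \<le> d k"
  shows "psd (spectral_mat n R d)"
proof -
  have "dim_row (spectral_mat n R d) = n" using R by simp
  then show ?thesis
    unfolding psd_def using mat_adjoint_spectral[OF R] spectral_mat_carrier[OF R]
      quadratic_form_spectral[OF R] d
    by (auto intro!: sum_nonneg)
qed

lemma spectral_nonneg_of_psd:
  assumes uR: "unitary_mat n R" and psd: "psd (spectral_mat n R d)" and k: "k < n"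
  shows "0 \<le> d k"
proof -
  note R = unitary_matD[OF uR]
  have "col R k \<in> carrier_vec n" "dim_row (spectral_mat n R d) = n" using R(1) by auto
  then have "0 \<le> Re (\<Sum>i<n. cnj (col R k $ i) * (spectral_mat n R d *\<^sub>v col R k) $ i)"
    using psd unfolding psd_def by simp
  then show ?thesis unfolding quadratic_form_column[OF uR k] by simp
qed

section \<open>Positive square roots and the trace norm\<close>

text \<open>Diagonalize \<open>B\<close> and \<open>C\<close> in separate bases and let
  \<open>W\<close> be the transition matrix. Equality of squares says that
  \<open>b i * b i = c j * c j\<close> wherever \<open>W $$ (i, j)\<close> is nonzero; nonnegative
  numbers with equal squares agree, and the same entrywise criterion then returns
  \<open>B = C\<close>.\<close>

lemma psd_sqrt_unique:
  assumes B: "B \<in> carrier_mat n n" "psd B" and C: "C \<in> carrier_mat n n" "psd C"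
    and sq: "B * B = C * C"
  shows "B = C"
proof -
  obtain R b where uR: "unitary_mat n R" and BR: "B = spectral_mat n R b"
    using hermitian_spectral[of B n] B unfolding psd_def by auto
  obtain S c where uS: "unitary_mat n S" and CS: "C = spectral_mat n S c"
    using hermitian_spectral[of C n] C unfolding psd_def by auto
  note R = unitary_matD[OF uR] and S = unitary_matD[OF uS]
  define W where "W = mat_adjoint R * S"
  have W: "W \<in> carrier_mat n n" unfolding W_def using R(2) S(1) by (rule mult_carrier_mat)
  have intertwine: "spectral_mat n R d = spectral_mat n S e \<longleftrightarrow>
      mat_diag n (\<lambda>i. complex_of_real (d i)) * W = W * mat_diag n (\<lambda>i. complex_of_real (e i))"
    (is "?l \<longleftrightarrow> ?D * W = W * ?E") for d e
  proof -
    have DE: "?D \<in> carrier_mat n n" "?E \<in> carrier_mat n n" by simp_all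
    have l: "mat_adjoint R * spectral_mat n R d * S = ?D * W"
    proof -
      have "mat_adjoint R * spectral_mat n R d = ?D * mat_adjoint R"
        using assoc_mult_mat[OF R(2,1), of "?D * mat_adjoint R" n] assoc_mult_mat[OF R(1) DE(1) R(2)]
          mult_carrier_mat[OF DE(1) R(2)] left_mult_one_mat[OF mult_carrier_mat[OF DE(1) R(2)]] R(3) by simp
      then show ?thesis unfolding W_def using assoc_mult_mat[OF DE(1) R(2) S(1)] by simp
    qed
    have r: "mat_adjoint R * spectral_mat n S e * S = W * ?E"
    proof -
      have SE: "S * ?E \<in> carrier_mat n n" by (rule mult_carrier_mat[OF S(1) DE(2)])
      have "spectral_mat n S e * S = S * ?E"
        using assoc_mult_mat[OF SE S(2,1)] S(3) right_mult_one_mat[OF SE] by simp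
      then show ?thesis unfolding W_def
        using assoc_mult_mat[OF R(2) spectral_mat_carrier[OF S(1)] S(1)] assoc_mult_mat[OF R(2) S(1) DE(2)] by simp
    qed
    \<comment> \<open>Passing from \<open>M\<close> to \<open>mat_adjoint R * M * S\<close> is
      invertible, so equality may be tested after it; this gives both directions of
      \<open>intertwine\<close>.\<close>
    have cancel: "R * (mat_adjoint R * M * S) * mat_adjoint S = M" if M: "M \<in> carrier_mat n n" for M
    proof -
      have MS: "M * S \<in> carrier_mat n n" using M S(1) by (rule mult_carrier_mat)
      have "R * (mat_adjoint R * M * S) = M * S"
        using assoc_mult_mat[OF R(2) M S(1)] assoc_mult_mat[OF R(1,2) MS] R(4) left_mult_one_mat[OF MS] by simp
      then show ?thesis using assoc_mult_mat[OF M S(1,2)] S(4) right_mult_one_mat[OF M] by simp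
    qed
    show ?thesis
      using l r cancel[OF spectral_mat_carrier[OF R(1)], of d] cancel[OF spectral_mat_carrier[OF S(1)], of e]
      by metis
  qed
  have entries: "mat_diag n (\<lambda>i. complex_of_real (d i)) * W = W * mat_diag n (\<lambda>i. complex_of_real (e i)) \<longleftrightarrow>
      (\<forall>i<n. \<forall>j<n. complex_of_real (d i) * W $$ (i, j) = W $$ (i, j) * complex_of_real (e j))" for d e
    unfolding mat_diag_mult_left[OF W] mat_diag_mult_right[OF W] by (auto simp: mat_eq_iff)
  have "spectral_mat n R (\<lambda>i. b i * b i) = spectral_mat n S (\<lambda>i. c i * c i)"
    using sq unfolding BR CS spectral_mat_mult[OF uR] spectral_mat_mult[OF uS] .
  then have sq_entries: "\<forall>i<n. \<forall>j<n. complex_of_real (b i * b i) * W $$ (i, j) = W $$ (i, j) * complex_of_real (c j * c j)"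
    unfolding intertwine entries .
  have nonneg_root: "b i = c i'" if "b i * b i = c i' * c i'" "i < n" "i' < n" for i i'
    using that spectral_nonneg_of_psd[OF uR, of b i] spectral_nonneg_of_psd[OF uS, of c i'] B(2) C(2)
    unfolding BR CS by (simp flip: power2_eq_square)
  have "complex_of_real (b i) * W $$ (i, j) = W $$ (i, j) * complex_of_real (c j)"
    if ij: "i < n" "j < n" for i j
  proof (cases "W $$ (i, j) = 0")
    case False
    then have "complex_of_real (b i * b i) = complex_of_real (c j * c j)"
      using sq_entries ij by (metis mult.commute mult_cancel_left)
    then have "b i * b i = c j * c j" unfolding of_real_eq_iff .
    then show ?thesis using nonneg_root ij by simp
  qed simp
  then show ?thesis unfolding BR CS intertwine entries by blast
qed

lemma psd_sqrt_eqI: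
  assumes "B \<in> carrier_mat n n" "psd B" "B * B = A"
  shows "psd_sqrt A = B"
proof -
  have "dim_row (B * B) = n" using assms(1) by simp
  then have n: "dim_row A = n" unfolding assms(3) .
  show ?thesis
    unfolding psd_sqrt_def n
  proof (rule the_equality)
    fix C assume "C \<in> carrier_mat n n \<and> psd C \<and> C * C = A"
    then have C: "C \<in> carrier_mat n n" "psd C" "C * C = A" by auto
    show "C = B" by (rule psd_sqrt_unique[OF C(1,2) assms(1,2)]) (simp only: C(3) assms(3))
  qed (intro conjI assms)
qed

text \<open>The absolute values of the eigenvalues, in the same basis, form a positive matrix whose
  square is that of the original one.\<close>

lemma trace_norm_spectral:
  assumes uR: "unitary_mat n R"
  shows "trace_norm (spectral_mat n R d) = (\<Sum>k<n. \<bar>d k\<bar>)"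
proof -
  note R = unitary_matD[OF uR]
  have "psd_sqrt (mat_adjoint (spectral_mat n R d) * spectral_mat n R d) = spectral_mat n R (\<lambda>k. \<bar>d k\<bar>)"
    unfolding mat_adjoint_spectral[OF R(1)]
    by (rule psd_sqrt_eqI[OF spectral_mat_carrier[OF R(1)] psd_spectral[OF R(1)]])
      (simp_all add: spectral_mat_mult[OF uR])
  then show ?thesis unfolding trace_norm_def by (simp add: mtrace_spectral[OF uR])
qed

lemma trace_norm_diag: "trace_norm (mat_diag n (\<lambda>i. complex_of_real (d i))) = (\<Sum>k<n. \<bar>d k\<bar>)"
proof -
  have adj: "mat_adjoint (1\<^sub>m n) = (1\<^sub>m n :: complex mat)" by (rule eq_matI) auto
  then have "unitary_mat n (1\<^sub>m n)" unfolding unitary_mat_def by simp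
  from trace_norm_spectral[OF this, of d] show ?thesis
    by (simp only: adj left_mult_one_mat[OF mat_diag_dim] right_mult_one_mat[OF mat_diag_dim])
qed


section \<open>Strictness of the trace norm bound\<close>

text \<open>The factors are the inner products of \<open>a\<close> and \<open>b\<close> with the
  columns of \<open>R\<close>; row orthonormality collapses the double sum. It is used with
  \<open>a = b\<close> for norms and with distinct vectors for overlaps.\<close>

lemma unitary_parseval:
  fixes a b :: "nat \<Rightarrow> complex"
  assumes uR: "unitary_mat n R"
  shows "(\<Sum>i<n. (\<Sum>s<n. cnj (a s) * R $$ (s, i)) * cnj (\<Sum>t<n. cnj (b t) * R $$ (t, i))) =
    (\<Sum>s<n. cnj (a s) * b s)"
proof -
  have "(\<Sum>i<n. (\<Sum>s<n. cnj (a s) * R $$ (s, i)) * cnj (\<Sum>t<n. cnj (b t) * R $$ (t, i))) =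
      (\<Sum>i<n. \<Sum>s<n. \<Sum>t<n. cnj (a s) * b t * (R $$ (s, i) * cnj (R $$ (t, i))))"
    unfolding cnj_sum sum_product by (simp add: mult_ac)
  also have "\<dots> = (\<Sum>s<n. \<Sum>i<n. \<Sum>t<n. cnj (a s) * b t * (R $$ (s, i) * cnj (R $$ (t, i))))"
    by (rule sum.swap)
  also have "\<dots> = (\<Sum>s<n. \<Sum>t<n. \<Sum>i<n. cnj (a s) * b t * (R $$ (s, i) * cnj (R $$ (t, i))))"
    by (intro sum.cong refl sum.swap)
  also have "\<dots> = (\<Sum>s<n. \<Sum>t<n. if s = t then cnj (a s) * b t else 0)"
    unfolding sum_distrib_left[symmetric]
    by (intro sum.cong refl) (simp add: unitary_rows[OF uR])
  also have "\<dots> = (\<Sum>s<n. cnj (a s) * b s)"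
    by (intro sum.cong refl) simp
  finally show ?thesis .
qed

text \<open>The negative term makes the sum itself too small, the positive term makes its negative
  too small.\<close>

lemma abs_sum_less_sum_abs:
  fixes f :: "'k \<Rightarrow> real"
  assumes K: "finite K" and k: "k \<in> K" "0 < f k" and l: "l \<in> K" "f l < 0"
  shows "\<bar>sum f K\<bar> < (\<Sum>k\<in>K. \<bar>f k\<bar>)"
proof -
  have "sum f K < (\<Sum>k\<in>K. \<bar>f k\<bar>)"
    using K l by (intro sum_strict_mono_ex1) (auto intro!: bexI[of _ l])
  moreover have "(\<Sum>k\<in>K. - f k) < (\<Sum>k\<in>K. \<bar>f k\<bar>)"
    using K k by (intro sum_strict_mono_ex1) (auto intro!: bexI[of _ k])
  ultimately show ?thesis by (simp add: sum_negf abs_less_iff)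
qed

text \<open>In an eigenbasis of \<open>X\<close>, each eigenvalue is the weighted sum of the squared overlaps with the
  vectors \<open>a k\<close>. Two non-orthogonal vectors of opposite weight both overlap with a common
  eigenvector, and there they cancel.\<close>

lemma trace_norm_weighted_proj_less:
  fixes X :: "complex mat" and c :: "'k \<Rightarrow> real" and a :: "'k \<Rightarrow> nat \<Rightarrow> complex"
  assumes K: "finite K" and X: "X \<in> carrier_mat n n"
    and entries: "\<And>i j. i < n \<Longrightarrow> j < n \<Longrightarrow> X $$ (i, j) = (\<Sum>k\<in>K. c k * a k i * cnj (a k j))"
    and norm: "\<And>k. k \<in> K \<Longrightarrow> (\<Sum>j<n. cnj (a k j) * a k j) = 1"
    and k: "k \<in> K" "0 < c k" and l: "l \<in> K" "c l < 0"
    and overlap: "(\<Sum>j<n. cnj (a k j) * a l j) \<noteq> 0"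
  shows "trace_norm X < (\<Sum>k\<in>K. \<bar>c k\<bar>)"
proof -
  have "mat_adjoint X = X"
  proof (rule eq_matI)
    fix i j assume "i < dim_row X" "j < dim_col X"
    then have ij: "i < n" "j < n" using X by auto
    then have "mat_adjoint X $$ (i, j) = cnj (X $$ (j, i))"
      using X by (intro index_mat_adjoint) auto
    also have "\<dots> = X $$ (i, j)"
      unfolding entries[OF ij] entries[OF ij(2,1)] cnj_sum by (intro sum.cong) (simp_all add: mult_ac)
    finally show "mat_adjoint X $$ (i, j) = X $$ (i, j)" .
  qed (use X in auto)
  then obtain R d where uR: "unitary_mat n R" and XR: "X = spectral_mat n R d"
    using hermitian_spectral[OF X] by blast
  note R = unitary_matD[OF uR]
  define w where "w k i = (\<Sum>j<n. cnj (a k j) * R $$ (j, i))" for k i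
  have d: "d i = (\<Sum>k\<in>K. c k * (cmod (w k i))\<^sup>2)" if i: "i < n" for i
  proof -
    have "col R i \<in> carrier_vec n" using R(1) by auto
    then have "(\<Sum>j<n. cnj (col R i $ j) * (X *\<^sub>v col R i) $ j) =
        complex_of_real (\<Sum>k\<in>K. c k * (cmod (\<Sum>j<n. cnj (a k j) * col R i $ j))\<^sup>2)"
      by (rule quadratic_form_weighted_proj[OF X, where a = a]) (rule entries)
    then have "d i = (\<Sum>k\<in>K. c k * (cmod (\<Sum>j<n. cnj (a k j) * col R i $ j))\<^sup>2)"
      unfolding XR quadratic_form_column[OF uR i] of_real_eq_iff .
    then show ?thesis unfolding w_def using R(1) i by simp
  qed
  have abs_term: "\<bar>c k * (cmod (w k i))\<^sup>2\<bar> = \<bar>c k\<bar> * (cmod (w k i))\<^sup>2" for k i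
    by (simp add: abs_mult)
  have total: "(\<Sum>i<n. (cmod (w k i))\<^sup>2) = 1" if "k \<in> K" for k
  proof -
    have "complex_of_real (\<Sum>i<n. (cmod (w k i))\<^sup>2) = (\<Sum>i<n. w k i * cnj (w k i))"
      by (simp only: of_real_sum complex_norm_square)
    also have "\<dots> = 1"
      unfolding w_def unitary_parseval[OF uR] using norm[OF that] .
    finally show ?thesis by (simp only: of_real_eq_1_iff)
  qed
  \<comment> \<open>Parseval turns the overlap into a sum over eigenvectors; being nonzero, it has a
    term where both coefficients are nonzero.\<close>
  have "(\<Sum>i<n. w k i * cnj (w l i)) \<noteq> 0"
    unfolding w_def unitary_parseval[OF uR] by (rule overlap)
  then have "\<not> (\<forall>i\<in>{..<n}. w k i * cnj (w l i) = 0)" by (rule contrapos_nn) (rule sum.neutral)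
  then obtain i where i: "i < n" "w k i \<noteq> 0" "w l i \<noteq> 0" by auto
  have "(\<Sum>i<n. \<bar>d i\<bar>) < (\<Sum>i<n. \<Sum>k\<in>K. \<bar>c k\<bar> * (cmod (w k i))\<^sup>2)"
  proof (rule sum_strict_mono_ex1)
    show "\<forall>i\<in>{..<n}. \<bar>d i\<bar> \<le> (\<Sum>k\<in>K. \<bar>c k\<bar> * (cmod (w k i))\<^sup>2)"
      using sum_abs[of "\<lambda>k. c k * (cmod (w k i))\<^sup>2" K for i] by (simp add: d abs_mult)
    have "\<bar>d i\<bar> < (\<Sum>k\<in>K. \<bar>c k\<bar> * (cmod (w k i))\<^sup>2)"
      unfolding d[OF i(1)] abs_term[symmetric] using K k l i
      by (intro abs_sum_less_sum_abs[of K k _ l]) (auto simp: mult_neg_pos)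
    then show "\<exists>i\<in>{..<n}. \<bar>d i\<bar> < (\<Sum>k\<in>K. \<bar>c k\<bar> * (cmod (w k i))\<^sup>2)"
      using i(1) by blast
  qed simp
  \<comment> \<open>Each unit vector distributes total weight one over the eigenbasis, so only the
    absolute weights survive.\<close>
  also have "\<dots> = (\<Sum>k\<in>K. \<Sum>i<n. \<bar>c k\<bar> * (cmod (w k i))\<^sup>2)" by (rule sum.swap)
  also have "\<dots> = (\<Sum>k\<in>K. \<bar>c k\<bar>)"
    unfolding sum_distrib_left[symmetric] by (intro sum.cong) (simp_all add: total)
  finally show ?thesis unfolding XR trace_norm_spectral[OF uR] .
qed

section \<open>Pure states under mixtures of conjugations\<close>

lemma dim_proj [simp]: "dim_row (proj \<psi>) = dim_vec \<psi>" "dim_col (proj \<psi>) = dim_vec \<psi>"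
  unfolding proj_def by simp_all

lemma proj_carrier [simp]: "\<psi> \<in> carrier_vec n \<Longrightarrow> proj \<psi> \<in> carrier_mat n n"
  unfolding proj_def by auto

lemma index_proj:
  "\<psi> \<in> carrier_vec n \<Longrightarrow> i < n \<Longrightarrow> j < n \<Longrightarrow> proj \<psi> $$ (i, j) = \<psi> $ i * cnj (\<psi> $ j)"
  unfolding proj_def by auto

lemma density_mat_proj:
  assumes \<psi>: "\<psi> \<in> carrier_vec n" and norm: "(\<Sum>i<n. \<psi> $ i * cnj (\<psi> $ i)) = 1"
  shows "density_mat n (proj \<psi>)"
proof -
  have dim: "dim_row (proj \<psi>) = n" "dim_vec \<psi> = n" using \<psi> by (auto simp: proj_def)
  have "mat_adjoint (proj \<psi>) = proj \<psi>"
    by (rule eq_matI) (simp_all add: proj_def)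
  moreover have "0 \<le> Re (\<Sum>i<n. cnj (v $ i) * (proj \<psi> *\<^sub>v v) $ i)" if "v \<in> carrier_vec n" for v
  proof -
    have "(\<Sum>i<n. cnj (v $ i) * (proj \<psi> *\<^sub>v v) $ i) =
        complex_of_real (\<Sum>k\<in>{()}. 1 * (cmod (\<Sum>j<n. cnj (\<psi> $ j) * v $ j))\<^sup>2)"
      by (rule quadratic_form_weighted_proj[OF proj_carrier[OF \<psi>] that, where a = "\<lambda>_ i. \<psi> $ i"])
        (simp add: index_proj[OF \<psi>])
    then show ?thesis by simp
  qed
  ultimately have "psd (proj \<psi>)" unfolding psd_def dim using proj_carrier[OF \<psi>] by blast
  moreover have "mtrace (proj \<psi>) = 1"
    unfolding mtrace_def dim using norm by (simp add: index_proj[OF \<psi>])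
  ultimately show ?thesis unfolding density_mat_def using proj_carrier[OF \<psi>] by blast
qed

text \<open>Keeps every term of a mixture rank-one, the shape that
  \<open>trace_norm_weighted_proj_less\<close> asks for.\<close>

lemma conj_proj:
  assumes U: "U \<in> carrier_mat n n" and \<psi>: "\<psi> \<in> carrier_vec n"
  shows "U * proj \<psi> * mat_adjoint U = proj (U *\<^sub>v \<psi>)"
proof (rule eq_matI)
  have U\<psi>: "U *\<^sub>v \<psi> \<in> carrier_vec n" using U \<psi> by simp
  have UP: "U * proj \<psi> \<in> carrier_mat n n" by (rule mult_carrier_mat[OF U proj_carrier[OF \<psi>]])
  fix i j assume "i < dim_row (proj (U *\<^sub>v \<psi>))" "j < dim_col (proj (U *\<^sub>v \<psi>))"
  then have ij: "i < n" "j < n" using U by (simp_all add: proj_def)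
  have left: "(U * proj \<psi>) $$ (i, k) = (U *\<^sub>v \<psi>) $ i * cnj (\<psi> $ k)" if k: "k < n" for k
  proof -
    have "(U * proj \<psi>) $$ (i, k) = (\<Sum>l<n. U $$ (i, l) * proj \<psi> $$ (l, k))"
      by (rule index_mult_mat_sum[OF U proj_carrier[OF \<psi>] ij(1) k])
    also have "\<dots> = (\<Sum>l<n. U $$ (i, l) * \<psi> $ l) * cnj (\<psi> $ k)"
      using k by (simp add: index_proj[OF \<psi>] sum_distrib_right mult.assoc)
    finally show ?thesis unfolding index_mult_mat_vec_sum[OF U \<psi> ij(1)] .
  qed
  have "(U * proj \<psi> * mat_adjoint U) $$ (i, j) = (\<Sum>k<n. (U * proj \<psi>) $$ (i, k) * mat_adjoint U $$ (k, j))"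
    by (rule index_mult_mat_sum[OF UP mat_adjoint_carrier[OF U] ij])
  also have "\<dots> = (\<Sum>k<n. (U *\<^sub>v \<psi>) $ i * (cnj (\<psi> $ k) * cnj (U $$ (j, k))))"
    using U ij by (intro sum.cong) (simp_all add: left del: index_mult_mat(1) index_mult_mat_vec)
  also have "\<dots> = (U *\<^sub>v \<psi>) $ i * cnj ((U *\<^sub>v \<psi>) $ j)"
    unfolding sum_distrib_left[symmetric] index_mult_mat_vec_sum[OF U \<psi> ij(2)] cnj_sum by (simp add: mult.commute)
  finally show "(U * proj \<psi> * mat_adjoint U) $$ (i, j) = proj (U *\<^sub>v \<psi>) $$ (i, j)"
    unfolding index_proj[OF U\<psi> ij] .
qed (use U in \<open>simp_all add: proj_def\<close>)

lemma mix3_proj_carrier: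
  assumes "U1 \<in> carrier_mat n n" "U2 \<in> carrier_mat n n" "U3 \<in> carrier_mat n n" "\<psi> \<in> carrier_vec n"
  shows "mix3 q1 q2 q3 U1 U2 U3 (proj \<psi>) \<in> carrier_mat n n"
  unfolding mix3_def using assms by (simp add: conj_proj)

lemma index_mix3_proj:
  assumes "U1 \<in> carrier_mat n n" "U2 \<in> carrier_mat n n" "U3 \<in> carrier_mat n n" "\<psi> \<in> carrier_vec n"
    and "i < n" "j < n"
  shows "mix3 q1 q2 q3 U1 U2 U3 (proj \<psi>) $$ (i, j) =
    q1 * (U1 *\<^sub>v \<psi>) $ i * cnj ((U1 *\<^sub>v \<psi>) $ j) +
    q2 * (U2 *\<^sub>v \<psi>) $ i * cnj ((U2 *\<^sub>v \<psi>) $ j) +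
    q3 * (U3 *\<^sub>v \<psi>) $ i * cnj ((U3 *\<^sub>v \<psi>) $ j)"
proof -
  note c = mult_mat_vec_carrier[OF assms(1,4)] mult_mat_vec_carrier[OF assms(2,4)] mult_mat_vec_carrier[OF assms(3,4)]
  show ?thesis
    unfolding mix3_def conj_proj[OF assms(1,4)] conj_proj[OF assms(2,4)] conj_proj[OF assms(3,4)]
    using assms by (simp add: c[THEN index_proj] mult.assoc del: index_mult_mat_vec)
qed

section \<open>Swaps, with and without the ancilla\<close>

lemma swap_mat_carrier [simp]: "swap_mat a \<in> carrier_mat 6 6"
  unfolding swap_mat_def by simp

text \<open>Swapping 0 with itself is the identity, so the six unitaries form one family indexed by
  \<open>k < 6\<close>.\<close>

lemma one_eq_swap_mat: "1\<^sub>m 6 = swap_mat 0"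
  by (rule eq_matI) (auto simp: swap_mat_def swp_def)

lemma swap_mat_unit_vec:
  assumes "a < 6"
  shows "swap_mat a *\<^sub>v unit_vec 6 0 = unit_vec 6 a"
proof (rule eq_vecI)
  fix i assume "i < dim_vec (unit_vec 6 a :: complex vec)"
  then have i: "i < 6" by simp
  have "(swap_mat a *\<^sub>v unit_vec 6 0) $ i = (\<Sum>j<6. swap_mat a $$ (i, j) * unit_vec 6 0 $ j)"
    by (rule index_mult_mat_vec_sum[OF swap_mat_carrier unit_vec_carrier i])
  also have "\<dots> = (\<Sum>j<6. if j = 0 then swap_mat a $$ (i, j) else 0)"
    by (intro sum.cong) simp_all
  also have "\<dots> = unit_vec 6 a $ i"
    using i assms by (simp add: swap_mat_def swp_def)
  finally show "(swap_mat a *\<^sub>v unit_vec 6 0) $ i = unit_vec 6 a $ i" .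
qed (simp add: swap_mat_def)

lemma swp_swp [simp]: "swp a (swp a i) = i"
  unfolding swp_def by auto

lemma swp_less: "a < n \<Longrightarrow> i < n \<Longrightarrow> swp a i < n"
  unfolding swp_def by auto

lemma kron_swap_carrier [simp]: "kron (swap_mat a) (1\<^sub>m 6) \<in> carrier_mat 36 36"
  unfolding kron_def swap_mat_def by simp

lemma kron_one_eq_swap: "kron (1\<^sub>m 6) (1\<^sub>m 6) = kron (swap_mat 0) (1\<^sub>m 6)"
  by (simp add: one_eq_swap_mat)

text \<open>A permutation matrix reads its argument at the inverse permutation, and a swap is its
  own inverse.\<close>

lemma kron_swap_mult_vec:
  assumes a: "a < 6" and \<psi>: "\<psi> \<in> carrier_vec 36" and ij: "i < 6" "j < 6"
  shows "(kron (swap_mat a) (1\<^sub>m 6) *\<^sub>v \<psi>) $ (i * 6 + j) = \<psi> $ (swp a i * 6 + j)"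
proof -
  have lt: "i * 6 + j < 36" "swp a i * 6 + j < 36" using ij swp_less[OF a ij(1)] by linarith+
  have entry: "kron (swap_mat a) (1\<^sub>m 6) $$ (i * 6 + j, l) = (if l = swp a i * 6 + j then 1 else 0)"
    if l: "l < 36" for l
  proof -
    have "kron (swap_mat a) (1\<^sub>m 6) $$ (i * 6 + j, l) =
        swap_mat a $$ (i, l div 6) * 1\<^sub>m 6 $$ (j, l mod 6)"
      using lt(1) l ij by (simp add: kron_def swap_mat_def)
    also have "\<dots> = (if i = swp a (l div 6) \<and> j = l mod 6 then 1 else 0)"
      using l ij by (simp add: swap_mat_def)
    also have "i = swp a (l div 6) \<and> j = l mod 6 \<longleftrightarrow> l = swp a i * 6 + j"
    proof
      assume "i = swp a (l div 6) \<and> j = l mod 6"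
      then show "l = swp a i * 6 + j" by simp
    next
      assume "l = swp a i * 6 + j"
      then have "l div 6 = swp a i" "l mod 6 = j" using ij(2) by simp_all
      then show "i = swp a (l div 6) \<and> j = l mod 6" by simp
    qed
    finally show ?thesis .
  qed
  have "(kron (swap_mat a) (1\<^sub>m 6) *\<^sub>v \<psi>) $ (i * 6 + j) =
      (\<Sum>l<36. kron (swap_mat a) (1\<^sub>m 6) $$ (i * 6 + j, l) * \<psi> $ l)"
    by (rule index_mult_mat_vec_sum[OF kron_swap_carrier \<psi> lt(1)])
  also have "\<dots> = (\<Sum>l<36. if l = swp a i * 6 + j then \<psi> $ l else 0)"
    by (intro sum.cong refl) (simp add: entry)
  also have "\<dots> = \<psi> $ (swp a i * 6 + j)" using lt(2) by simp
  finally show ?thesis .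
qed

lemma sum_lessThan_mult:
  fixes f :: "nat \<Rightarrow> 'a::comm_monoid_add"
  shows "(\<Sum>l<m * n. f l) = (\<Sum>i<m. \<Sum>j<n. f (i * n + j))"
proof -
  have "sum f {i * n..<i * n + n} = (\<Sum>j<n. f (i * n + j))" for i
    using sum.shift_bounds_nat_ivl[of f 0 "i * n" n] by (simp add: add.commute lessThan_atLeast0)
  then show ?thesis using sum.nat_group[of f n m] by simp
qed

text \<open>Summing out the ancilla index produces entries of the reduced state, which is the
  identity divided by 6: every label on which the two swaps agree contributes
  \<open>1 / 6\<close>.\<close>

lemma max_entangled_swap_overlap:
  assumes \<psi>: "max_entangled 6 \<psi>" and ab: "a < 6" "b < 6"
  shows "(\<Sum>l<36. cnj ((kron (swap_mat a) (1\<^sub>m 6) *\<^sub>v \<psi>) $ l) * (kron (swap_mat b) (1\<^sub>m 6) *\<^sub>v \<psi>) $ l) =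
    (\<Sum>i<6. if swp a i = swp b i then 1 / 6 else 0)"
proof -
  have c: "\<psi> \<in> carrier_vec 36" using \<psi> unfolding max_entangled_def by simp
  have pt: "ptrace_B 6 6 (proj \<psi>) = (1 / of_nat 6) \<cdot>\<^sub>m 1\<^sub>m 6" using \<psi> unfolding max_entangled_def by simp
  have "(\<Sum>l<6 * 6. cnj ((kron (swap_mat a) (1\<^sub>m 6) *\<^sub>v \<psi>) $ l) * (kron (swap_mat b) (1\<^sub>m 6) *\<^sub>v \<psi>) $ l) =
      (\<Sum>i<6. \<Sum>j<6. cnj (\<psi> $ (swp a i * 6 + j)) * \<psi> $ (swp b i * 6 + j))"
    unfolding sum_lessThan_mult
    by (intro sum.cong refl) (simp add: kron_swap_mult_vec[OF ab(1) c] kron_swap_mult_vec[OF ab(2) c] del: index_mult_mat_vec)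
  also have "\<dots> = (\<Sum>i<6. if swp a i = swp b i then 1 / 6 else 0)"
  proof (intro sum.cong refl)
    fix i :: nat assume "i \<in> {..<6}"
    then have lt: "swp a i < 6" "swp b i < 6" using swp_less ab by simp_all
    have idx: "k * 6 + j < 36" if "k < 6" "j < 6" for k j :: nat using that by linarith
    \<comment> \<open>The conjugated factor supplies the column index of the reduced state, hence
      the reversed order of \<open>b\<close> and \<open>a\<close>.\<close>
    have "(\<Sum>j<6. cnj (\<psi> $ (swp a i * 6 + j)) * \<psi> $ (swp b i * 6 + j)) =
        ptrace_B 6 6 (proj \<psi>) $$ (swp b i, swp a i)"
      using lt by (simp add: ptrace_B_def index_proj[OF c] idx mult.commute)
    also have "\<dots> = (if swp a i = swp b i then 1 / 6 else 0)"
      unfolding pt using lt by simp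
    finally show "(\<Sum>j<6. cnj (\<psi> $ (swp a i * 6 + j)) * \<psi> $ (swp b i * 6 + j)) =
        (if swp a i = swp b i then 1 / 6 else 0)" .
  qed
  finally show ?thesis by simp
qed

section \<open>Comparison of the two probes\<close>

lemma index_mix3_proj_diff:
  fixes U :: "nat \<Rightarrow> complex mat"
  assumes U: "\<And>k. U k \<in> carrier_mat n n" and \<psi>: "\<psi> \<in> carrier_vec n" and ij: "i < n" "j < n"
  shows "(mix3 q1 q2 q3 (U 0) (U 1) (U 2) (proj \<psi>) - mix3 q1 q2 q3 (U 3) (U 4) (U 5) (proj \<psi>)) $$ (i, j) =
    (\<Sum>k<6. complex_of_real ([q1, q2, q3, - q1, - q2, - q3] ! k) * (U k *\<^sub>v \<psi>) $ i * cnj ((U k *\<^sub>v \<psi>) $ j))"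
proof -
  have "mix3 q1 q2 q3 (U 3) (U 4) (U 5) (proj \<psi>) \<in> carrier_mat n n"
    by (intro mix3_proj_carrier U \<psi>)
  then show ?thesis
    using ij by (simp add: index_mix3_proj[OF U U U \<psi> ij] eval_nat_numeral del: index_mult_mat_vec)
qed

theorem theorem9:
  fixes q1 q2 q3 :: real
  assumes "0 < q1" "q1 < 1" "0 < q2" "q2 < 1" "0 < q3" "q3 < 1" "q1 + q2 + q3 = 1"
  shows "\<exists>\<rho>. density_mat 6 \<rho> \<and>
    (\<forall>\<psi>. max_entangled 6 \<psi> \<longrightarrow>
       1/2 + 1/4 * trace_norm (Lbar q1 q2 q3 \<rho> - Sbar q1 q2 q3 \<rho>)
       > 1/2 + 1/4 * trace_norm (Lbar_id q1 q2 q3 (proj \<psi>) - Sbar_id q1 q2 q3 (proj \<psi>)))"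
proof -
  define c where "c k = [q1, q2, q3, - q1, - q2, - q3] ! k" for k
  \<comment> \<open>The weights of each channel sum to 1, which makes 2 for both.\<close>
  have c_abs: "(\<Sum>k<6. \<bar>c k\<bar>) = 2"
    using assms by (simp add: c_def eval_nat_numeral)
  define e :: "complex vec" where "e = unit_vec 6 0"
  have e: "e \<in> carrier_vec 6" unfolding e_def by simp
  have density: "density_mat 6 (proj e)"
    by (rule density_mat_proj[OF e]) (simp add: e_def eval_nat_numeral)
  have single: "trace_norm (Lbar q1 q2 q3 (proj e) - Sbar q1 q2 q3 (proj e)) = 2"
  proof -
    have car: "Lbar q1 q2 q3 (proj e) - Sbar q1 q2 q3 (proj e) \<in> carrier_mat 6 6"
      unfolding Lbar_def Sbar_def one_eq_swap_mat by (intro minus_carrier_mat mix3_proj_carrier e swap_mat_carrier)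
    have "Lbar q1 q2 q3 (proj e) - Sbar q1 q2 q3 (proj e) = mat_diag 6 (\<lambda>k. complex_of_real (c k))"
    proof (rule eq_matI)
      fix i j assume "i < dim_row (mat_diag 6 (\<lambda>k. complex_of_real (c k)))"
        "j < dim_col (mat_diag 6 (\<lambda>k. complex_of_real (c k)))"
      then have ij: "i < 6" "j < 6" by (simp_all add: mat_diag_def)
      have "(Lbar q1 q2 q3 (proj e) - Sbar q1 q2 q3 (proj e)) $$ (i, j) =
          (\<Sum>k<6. c k * (swap_mat k *\<^sub>v e) $ i * cnj ((swap_mat k *\<^sub>v e) $ j))"
        unfolding Lbar_def Sbar_def one_eq_swap_mat c_def
        by (rule index_mix3_proj_diff[where U = swap_mat, OF swap_mat_carrier e ij])
      \<comment> \<open>The \<open>k\<close>-th output vector is the \<open>k\<close>-th basis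
        vector, so the difference is already diagonal.\<close>
      also have "\<dots> = (\<Sum>k<6. if k = i then (if i = j then complex_of_real (c k) else 0) else 0)"
        using ij by (intro sum.cong refl) (auto simp: e_def swap_mat_unit_vec simp del: index_mult_mat_vec)
      also have "\<dots> = mat_diag 6 (\<lambda>k. complex_of_real (c k)) $$ (i, j)"
        using ij by (simp add: mat_diag_def)
      finally show "(Lbar q1 q2 q3 (proj e) - Sbar q1 q2 q3 (proj e)) $$ (i, j) =
          mat_diag 6 (\<lambda>k. complex_of_real (c k)) $$ (i, j)" .
    qed (simp_all only: carrier_matD[OF car] carrier_matD[OF mat_diag_dim])
    then show ?thesis by (simp only: trace_norm_diag c_abs)
  qed
  have entangled: "trace_norm (Lbar_id q1 q2 q3 (proj \<psi>) - Sbar_id q1 q2 q3 (proj \<psi>)) < 2"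
    if \<psi>: "max_entangled 6 \<psi>" for \<psi>
  proof -
    have \<psi>c: "\<psi> \<in> carrier_vec 36" using \<psi> unfolding max_entangled_def by simp
    have "trace_norm (Lbar_id q1 q2 q3 (proj \<psi>) - Sbar_id q1 q2 q3 (proj \<psi>)) < (\<Sum>k<6. \<bar>c k\<bar>)"
    \<comment> \<open>Indices 0 and 3 are the first unitaries of the two channels, with opposite
      weights \<open>q1\<close> and \<open>- q1\<close>.\<close>
    proof (rule trace_norm_weighted_proj_less[where n = 36 and k = 0 and l = 3
          and a = "\<lambda>k i. (kron (swap_mat k) (1\<^sub>m 6) *\<^sub>v \<psi>) $ i"])
      show "Lbar_id q1 q2 q3 (proj \<psi>) - Sbar_id q1 q2 q3 (proj \<psi>) \<in> carrier_mat 36 36"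
        unfolding Lbar_id_def Sbar_id_def kron_one_eq_swap
        by (intro minus_carrier_mat mix3_proj_carrier \<psi>c kron_swap_carrier)
      show "(Lbar_id q1 q2 q3 (proj \<psi>) - Sbar_id q1 q2 q3 (proj \<psi>)) $$ (i, j) =
          (\<Sum>k<6. c k * (kron (swap_mat k) (1\<^sub>m 6) *\<^sub>v \<psi>) $ i * cnj ((kron (swap_mat k) (1\<^sub>m 6) *\<^sub>v \<psi>) $ j))"
        if "i < 36" "j < 36" for i j
        unfolding Lbar_id_def Sbar_id_def c_def kron_one_eq_swap
        by (rule index_mix3_proj_diff[where U = "\<lambda>k. kron (swap_mat k) (1\<^sub>m 6)", OF kron_swap_carrier \<psi>c that])
      \<comment> \<open>A swap agrees with itself on all six labels, giving six times
        \<open>1 / 6\<close>.\<close>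
      show "(\<Sum>j<36. cnj ((kron (swap_mat k) (1\<^sub>m 6) *\<^sub>v \<psi>) $ j) * (kron (swap_mat k) (1\<^sub>m 6) *\<^sub>v \<psi>) $ j) = 1"
        if "k \<in> {..<6}" for k
        using that by (subst max_entangled_swap_overlap[OF \<psi>]) simp_all
      \<comment> \<open>The labels 1, 2, 4 and 5 are fixed by both swaps.\<close>
      show "(\<Sum>j<36. cnj ((kron (swap_mat 0) (1\<^sub>m 6) *\<^sub>v \<psi>) $ j) * (kron (swap_mat 3) (1\<^sub>m 6) *\<^sub>v \<psi>) $ j) \<noteq> 0"
        by (subst max_entangled_swap_overlap[OF \<psi>]) (simp_all add: swp_def eval_nat_numeral)
      show "0 < c 0" "c 3 < 0" using assms by (simp_all add: c_def)
    qed simp_all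
    then show ?thesis unfolding c_abs .
  qed
  have "1/2 + 1/4 * trace_norm (Lbar_id q1 q2 q3 (proj \<psi>) - Sbar_id q1 q2 q3 (proj \<psi>))
      < 1/2 + 1/4 * trace_norm (Lbar q1 q2 q3 (proj e) - Sbar q1 q2 q3 (proj e))"
    if "max_entangled 6 \<psi>" for \<psi>
    using single entangled[OF that] by linarith
  then show ?thesis using density by blast
qed

end
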